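(* Let $\alpha\in(0,\tfrac5{12})$ and $\sigma,\sigma_1,\sigma_2,\sigma_3\in\{\pm1\}$. For any $s>0$ and any dyadic numbers $N_1,N_2,N_3$, $$\sup_{m\in\mathbb Z}\ \sum_{n_1,n_2,n_3\in\mathbb Z^2}\langle n_1+n_2+n_3\rangle^{2(s-1)}\Bigl[\prod_{j=1}^3\mathbf 1_{|n_j|\sim N_j}\langle n_j\rangle^{-2+2\alpha}\Bigr]\mathbf 1_{|\phi-m|\le1}\lesssim\max\{N_1,N_2,N_3\}^{2(s-s_\alpha)},$$ where $\phi=\phi(n_1,n_2,n_3)=\sigma\langle n_1+n_2+n_3\rangle+\sigma_1\langle n_1\rangle+\sigma_2\langle n_2\rangle+\sigma_3\langle n_3\rangle$ and $$s_\alpha=\begin{cases}1-2\alpha,&0<\alpha<\frac14,\\\frac54-3\alpha,&\frac14\le\alpha<\frac5{12}.\end{cases}$$ The implicit constant is independent of $N_1,N_2,N_3$.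
   Context: $\langle n\rangle=\sqrt{1+|n|^2}$ for $n\in\mathbb Z^2$. Dyadic numbers are of the form $2^k$, $k\in\mathbb N$. $|n|\sim N$ means $\frac12N\le|n|\le2N$. *)

theory Defs
  imports "HOL-Analysis.Analysis"
begin

(* Points of Z^2 are pairs of integers; the norm of their image in R^2 (real \<times> real) is the
   Euclidean one. *)
definition lattice_norm :: "int \<times> int \<Rightarrow> real" where
  "lattice_norm n = norm (real_of_int (fst n), real_of_int (snd n))"

definition japanese_bracket :: "int \<times> int \<Rightarrow> real" where
  "japanese_bracket n = sqrt (1 + (lattice_norm n)\<^sup>2)"

(* k = 0 is admitted, so 1 is dyadic. *)
definition dyadic :: "real \<Rightarrow> bool" where
  "dyadic N \<longleftrightarrow> (\<exists>k::nat. N = 2 ^ k)"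

definition size_comparable :: "int \<times> int \<Rightarrow> real \<Rightarrow> bool" where
  "size_comparable n N \<longleftrightarrow> 1/2 * N \<le> lattice_norm n \<and> lattice_norm n \<le> 2 * N"

definition phase ::
  "real \<Rightarrow> real \<Rightarrow> real \<Rightarrow> real \<Rightarrow> int \<times> int \<Rightarrow> int \<times> int \<Rightarrow> int \<times> int \<Rightarrow> real" where
  "phase \<sigma> \<sigma>1 \<sigma>2 \<sigma>3 n1 n2 n3 =
     \<sigma> * japanese_bracket (n1 + n2 + n3) + \<sigma>1 * japanese_bracket n1
       + \<sigma>2 * japanese_bracket n2 + \<sigma>3 * japanese_bracket n3"

(* Only the range 0 < \<alpha> < 5/12 is meaningful. *)
definition s_crit :: "real \<Rightarrow> real" where
  "s_crit \<alpha> = (if \<alpha> < 1/4 then 1 - 2 * \<alpha> else 5/4 - 3 * \<alpha>)"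

end

theory Submission
  imports Defs
begin

text \<open>
  The estimate is symmetric in the three frequencies, so one may assume \<open>N3 \<le> N2 \<le> N1\<close>. The weights of
  the \<open>n_j\<close> are constant on dyadic shells up to a bounded factor, and what has to be controlled is the
  number of resonant triples, weighted by a power of the bracket of \<open>n0 = n1 + n2 + n3\<close>.

  If \<open>n0\<close> and \<open>n3\<close> are fixed, then so is \<open>a = n0 - n3 = n1 + n2\<close>, and resonance confines \<open>n2\<close> to a unit
  neighbourhood of an ellipse or a branch of a hyperbola with foci \<open>0\<close> and \<open>a\<close>, up to the smoothing of the
  brackets. Such a neighbourhood contains, in the ball of radius \<open>R\<close>, at most
  \<open>O(R powr (3/2) + R\<^sup>2 * japanese_bracket a powr (- 1/2))\<close> lattice points (\<open>card_resonant_ball\<close>). To see this,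
  the ball is cut into unit annuli. In an annulus of radius \<open>K\<close> the distances of \<open>n2\<close> to both foci are
  known up to \<open>O(1)\<close>, so \<open>n2\<close> is located near one of two mirror images, up to an error of order
  \<open>sqrt K + K / sqrt A\<close>, where \<open>A\<close> is the length of \<open>a\<close> (\<open>resonant_points_same_side_close\<close>).
  A cluster of that diameter in a unit annulus contains no more lattice points than a curve of that length
  would, up to a constant (\<open>card_annulus_close\<close>).

  Taking \<open>R\<close> of order \<open>N2\<close>, the sum over \<open>n3\<close> of this bound is of order \<open>N2\<^sup>2 * N3 powr (3/2)\<close>, because the
  factor \<open>japanese_bracket (n0 - n3) powr (- 1/2)\<close> is locally summable and \<open>N3 \<le> N2\<close>. The sum over \<open>n0\<close> gives
  \<open>N1 powr (2 * s)\<close>, because \<open>0 < s\<close>. Together with the weights this is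
  \<open>N1 powr (2 * s - 2 + 2 * \<alpha>) * N2 powr (2 * \<alpha>) * N3 powr (2 * \<alpha> - 1/2)\<close>, and replacing \<open>N2\<close> by \<open>N1\<close>, and
  \<open>N3\<close> by 1 or \<open>N1\<close> according to the sign of its exponent, gives the two cases of \<open>s_crit\<close>.
\<close>

section \<open>The Japanese bracket on the lattice\<close>

lemma lattice_norm_sq: "(lattice_norm n)\<^sup>2 = (real_of_int (fst n))\<^sup>2 + (real_of_int (snd n))\<^sup>2"
  by (simp add: lattice_norm_def norm_Pair)

lemma lattice_norm_nonneg: "0 \<le> lattice_norm n"
  by (simp add: lattice_norm_def)

lemma japanese_bracket_sq:
  "(japanese_bracket n)\<^sup>2 = 1 + (real_of_int (fst n))\<^sup>2 + (real_of_int (snd n))\<^sup>2"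
  by (simp add: japanese_bracket_def lattice_norm_sq)

lemma japanese_bracket_ge_1: "1 \<le> japanese_bracket n"
  by (simp add: japanese_bracket_def)

lemma japanese_bracket_pos: "0 < japanese_bracket n"
  using japanese_bracket_ge_1[of n] by linarith

lemma lattice_norm_le_japanese_bracket: "lattice_norm n \<le> japanese_bracket n"
  unfolding japanese_bracket_def by (rule real_le_rsqrt) simp

lemma japanese_bracket_le_lattice_norm: "japanese_bracket n \<le> 1 + lattice_norm n"
  unfolding japanese_bracket_def using lattice_norm_nonneg[of n]
  by (intro real_le_lsqrt) (auto simp: power2_eq_square algebra_simps)

lemma lattice_norm_uminus: "lattice_norm (- n) = lattice_norm n"
  by (simp add: lattice_norm_def norm_Pair)

lemma lattice_norm_triangle: "lattice_norm (x + y) \<le> lattice_norm x + lattice_norm y"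
proof -
  have "lattice_norm (x + y) = norm ((real_of_int (fst x), real_of_int (snd x)) + (real_of_int (fst y), real_of_int (snd y)))"
    by (simp add: lattice_norm_def)
  also have "\<dots> \<le> lattice_norm x + lattice_norm y"
    unfolding lattice_norm_def by (rule norm_triangle_ineq)
  finally show ?thesis .
qed

lemma lattice_norm_ge_1: "a \<noteq> 0 \<Longrightarrow> 1 \<le> lattice_norm a"
proof -
  assume "a \<noteq> 0"
  then have "1 \<le> (fst a)\<^sup>2 + (snd a)\<^sup>2"
    by (smt (verit, best) zero_le_power2 power2_less_eq_zero_iff prod_eq_iff fst_zero snd_zero)
  then have "real_of_int 1 \<le> real_of_int ((fst a)\<^sup>2 + (snd a)\<^sup>2)"
    by (simp only: of_int_le_iff)
  then have "1\<^sup>2 \<le> (lattice_norm a)\<^sup>2" by (simp add: lattice_norm_sq)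
  then show ?thesis using lattice_norm_nonneg by (rule power2_le_imp_le)
qed

text \<open>The bracket of \<open>n\<close> is the Euclidean length of \<open>(1, n)\<close> in three-space, and is
  therefore 1-Lipschitz.\<close>

lemma japanese_bracket_triangle: "japanese_bracket (x + y) \<le> japanese_bracket x + lattice_norm y"
proof -
  have jb: "japanese_bracket n = norm (1::real, (real_of_int (fst n), real_of_int (snd n)))" for n
    by (simp add: japanese_bracket_def lattice_norm_sq norm_Pair)
  have "japanese_bracket (x + y) = norm ((1::real, (real_of_int (fst x), real_of_int (snd x)))
      + (0, (real_of_int (fst y), real_of_int (snd y))))"
    by (simp add: jb)
  also have "\<dots> \<le> japanese_bracket x + norm (0::real, (real_of_int (fst y), real_of_int (snd y)))"
    unfolding jb by (rule norm_triangle_ineq)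
  also have "norm (0::real, (real_of_int (fst y), real_of_int (snd y))) = lattice_norm y"
    by (simp add: lattice_norm_def norm_Pair)
  finally show ?thesis .
qed

section \<open>Power sums over balls\<close>

definition bracket_ball :: "real \<Rightarrow> (int \<times> int) set" where
  "bracket_ball R = {n. japanese_bracket n \<le> R}"

lemma bracket_ball_subset_square:
  "bracket_ball R \<subseteq> {- \<lfloor>R\<rfloor>..\<lfloor>R\<rfloor>} \<times> {- \<lfloor>R\<rfloor>..\<lfloor>R\<rfloor>}"
proof
  fix n assume "n \<in> bracket_ball R"
  then have R: "japanese_bracket n \<le> R" by (simp add: bracket_ball_def)
  have "\<bar>real_of_int (fst n)\<bar> \<le> japanese_bracket n" "\<bar>real_of_int (snd n)\<bar> \<le> japanese_bracket n"
    using japanese_bracket_pos[of n]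
    by (rule_tac [!] power2_le_imp_le) (simp_all add: japanese_bracket_sq)
  then have "\<bar>real_of_int (fst n)\<bar> \<le> R" "\<bar>real_of_int (snd n)\<bar> \<le> R" using R by linarith+
  then have "\<bar>fst n\<bar> \<le> \<lfloor>R\<rfloor>" "\<bar>snd n\<bar> \<le> \<lfloor>R\<rfloor>" by (simp_all add: le_floor_iff)
  then show "n \<in> {- \<lfloor>R\<rfloor>..\<lfloor>R\<rfloor>} \<times> {- \<lfloor>R\<rfloor>..\<lfloor>R\<rfloor>}" by (cases n) auto
qed

lemma finite_bracket_ball: "finite (bracket_ball R)"
  by (rule finite_subset[OF bracket_ball_subset_square]) simp

lemma card_bracket_ball_le:
  assumes "1 \<le> R"
  shows "real (card (bracket_ball R)) \<le> 9 * R\<^sup>2"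
proof -
  have "card (bracket_ball R) \<le> card ({- \<lfloor>R\<rfloor>..\<lfloor>R\<rfloor>} \<times> {- \<lfloor>R\<rfloor>..\<lfloor>R\<rfloor>})"
    by (intro card_mono bracket_ball_subset_square) simp
  also have "\<dots> = (nat (2 * \<lfloor>R\<rfloor> + 1))\<^sup>2"
    by (simp add: card_cartesian_product power2_eq_square)
  finally have "real (card (bracket_ball R)) \<le> (real (nat (2 * \<lfloor>R\<rfloor> + 1)))\<^sup>2"
    by (metis of_nat_le_iff of_nat_power)
  also have "real (nat (2 * \<lfloor>R\<rfloor> + 1)) = 2 * real_of_int \<lfloor>R\<rfloor> + 1"
    using assms by (subst of_nat_nat) auto
  also have "(2 * real_of_int \<lfloor>R\<rfloor> + 1)\<^sup>2 \<le> (3 * R)\<^sup>2"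
    using assms of_int_floor_le[of R] by (intro power_mono) (linarith, simp)
  finally show ?thesis by (simp add: power_mult_distrib)
qed

text \<open>The contribution of the dyadic shell at scale \<open>2 ^ k\<close> is of order \<open>(2 ^ k) powr \<gamma>\<close>, so the shells
  form a geometric series, and \<open>\<gamma> > 0\<close> makes the last one dominate. The induction on \<open>k\<close> sums
  that series: the constant \<open>C\<close> is chosen so that doubling the radius multiplies the bound by enough
  to absorb the new shell.\<close>

lemma sum_bracket_powr_ball:
  fixes \<gamma> :: real
  assumes "0 < \<gamma>"
  shows "\<exists>C>0. \<forall>k::nat. (\<Sum>n\<in>bracket_ball (2 ^ k). japanese_bracket n powr (\<gamma> - 2)) \<le> C * (2 ^ k) powr \<gamma>"
proof -
  define c where "c = 36 * 2 powr \<bar>\<gamma> - 2\<bar>"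
  have g: "2 powr \<gamma> > 1" using assms by simp
  have c0: "c > 0" by (simp add: c_def)
  define C where "C = 9 + c / (2 powr \<gamma> - 1)"
  have C9: "C \<ge> 9" using c0 g by (simp add: C_def)
  have Cc: "C + c \<le> C * 2 powr \<gamma>"
  proof -
    have "c = c / (2 powr \<gamma> - 1) * (2 powr \<gamma> - 1)"
      using g by (metis diff_gt_0_iff_gt nonzero_eq_divide_eq less_irrefl)
    also have "\<dots> \<le> C * (2 powr \<gamma> - 1)" using g by (intro mult_right_mono) (auto simp: C_def)
    finally show ?thesis by (simp add: algebra_simps)
  qed
  have "(\<Sum>n\<in>bracket_ball (2 ^ k). japanese_bracket n powr (\<gamma> - 2)) \<le> C * (2 ^ k) powr \<gamma>" for k :: nat
  proof (induction k)
    case 0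
    have "(\<Sum>n\<in>bracket_ball 1. japanese_bracket n powr (\<gamma> - 2)) = (\<Sum>n\<in>bracket_ball 1. 1)"
    proof (intro sum.cong refl)
      fix n assume "n \<in> bracket_ball 1"
      then have "japanese_bracket n = 1"
        using japanese_bracket_ge_1[of n] by (simp add: bracket_ball_def)
      then show "japanese_bracket n powr (\<gamma> - 2) = 1" by simp
    qed
    also have "\<dots> \<le> 9" using card_bracket_ball_le[of 1] by simp
    finally show ?case using C9 by simp
  next
    case (Suc k)
    define R :: real where "R = 2 ^ k"
    have R1: "R \<ge> 1" by (simp add: R_def)
    have sub: "bracket_ball R \<subseteq> bracket_ball (2 * R)" using R1 by (auto simp: bracket_ball_def)
    have "(\<Sum>n\<in>bracket_ball (2 * R). japanese_bracket n powr (\<gamma> - 2)) =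
        (\<Sum>n\<in>bracket_ball (2 * R) - bracket_ball R. japanese_bracket n powr (\<gamma> - 2))
        + (\<Sum>n\<in>bracket_ball R. japanese_bracket n powr (\<gamma> - 2))"
      by (rule sum.subset_diff[OF sub finite_bracket_ball])
    also have "(\<Sum>n\<in>bracket_ball (2 * R) - bracket_ball R. japanese_bracket n powr (\<gamma> - 2))
        \<le> real (card (bracket_ball (2 * R) - bracket_ball R)) * (2 powr \<bar>\<gamma> - 2\<bar> * R powr (\<gamma> - 2))"
    proof (rule sum_bounded_above)
      fix n assume n: "n \<in> bracket_ball (2 * R) - bracket_ball R"
      define t where "t = japanese_bracket n / R"
      have t: "1 \<le> t" "t \<le> 2" "japanese_bracket n = t * R"
        using n R1 by (auto simp: t_def bracket_ball_def field_simps)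
      have "t powr (\<gamma> - 2) \<le> t powr \<bar>\<gamma> - 2\<bar>" using t(1) by (intro powr_mono) auto
      also have "\<dots> \<le> 2 powr \<bar>\<gamma> - 2\<bar>" using t by (intro powr_mono2) auto
      finally have "t powr (\<gamma> - 2) \<le> 2 powr \<bar>\<gamma> - 2\<bar>" .
      then show "japanese_bracket n powr (\<gamma> - 2) \<le> 2 powr \<bar>\<gamma> - 2\<bar> * R powr (\<gamma> - 2)"
        unfolding t(3) using t R1 by (simp add: powr_mult mult_right_mono)
    qed
    also have "\<dots> \<le> (36 * R\<^sup>2) * (2 powr \<bar>\<gamma> - 2\<bar> * R powr (\<gamma> - 2))"
    proof (rule mult_right_mono)
      have "real (card (bracket_ball (2 * R) - bracket_ball R)) \<le> real (card (bracket_ball (2 * R)))"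
        by (simp add: card_mono finite_bracket_ball)
      also have "\<dots> \<le> 9 * (2 * R)\<^sup>2" using R1 by (intro card_bracket_ball_le) simp
      finally show "real (card (bracket_ball (2 * R) - bracket_ball R)) \<le> 36 * R\<^sup>2"
        by (simp add: power_mult_distrib)
    qed simp
    also have "\<dots> = c * R powr \<gamma>"
      using R1 by (simp add: c_def powr_diff)
    also have "c * R powr \<gamma> + (\<Sum>n\<in>bracket_ball R. japanese_bracket n powr (\<gamma> - 2)) \<le> (C + c) * R powr \<gamma>"
      using Suc.IH by (simp add: R_def algebra_simps)
    also have "\<dots> \<le> (C * 2 powr \<gamma>) * R powr \<gamma>" using Cc by (intro mult_right_mono) auto
    also have "\<dots> = C * (2 * R) powr \<gamma>" using R1 by (simp add: powr_mult)
    finally show ?case by (simp add: R_def)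
  qed
  then show ?thesis using C9 by (intro exI[of _ C]) auto
qed

text \<open>The sum is uniform in the centre \<open>b\<close>. Points far from \<open>b\<close> contribute at most the size of the ball
  times the value at distance \<open>2 ^ k\<close>; points near \<open>b\<close> are translated to a ball about the origin,
  where the previous bound with \<open>\<gamma> = 3/2\<close> applies.\<close>

lemma sum_bracket_translate_ball:
  "\<exists>C>0. \<forall>b. \<forall>k::nat. (\<Sum>n\<in>bracket_ball (2 ^ k). japanese_bracket (b - n) powr (- 1/2)) \<le> C * (2 ^ k) powr (3/2)"
proof -
  obtain C where C: "C > 0"
    "\<And>k::nat. (\<Sum>n\<in>bracket_ball (2 ^ k). japanese_bracket n powr (- 1/2)) \<le> C * (2 ^ k) powr (3/2)"
    using sum_bracket_powr_ball[of "3/2"] by auto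
  have "(\<Sum>n\<in>bracket_ball (2 ^ k). japanese_bracket (b - n) powr (- 1/2)) \<le> (C + 9) * (2 ^ k) powr (3/2)"
    for b and k :: nat
  proof -
    define R :: real where "R = 2 ^ k"
    have R1: "R \<ge> 1" by (simp add: R_def)
    let ?f = "\<lambda>n. japanese_bracket n powr (- 1/2)"
    let ?N = "{n \<in> bracket_ball R. b - n \<in> bracket_ball R}"
    have "(\<Sum>n\<in>bracket_ball R. ?f (b - n)) = (\<Sum>n\<in>bracket_ball R - ?N. ?f (b - n)) + (\<Sum>n\<in>?N. ?f (b - n))"
      by (rule sum.subset_diff) (auto simp: finite_bracket_ball)
    also have "(\<Sum>n\<in>?N. ?f (b - n)) = sum ?f ((\<lambda>n. b - n) ` ?N)"
      by (subst sum.reindex) (auto simp: inj_on_def)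
    also have "\<dots> \<le> sum ?f (bracket_ball R)"
      by (intro sum_mono2) (auto simp: finite_bracket_ball)
    also have "\<dots> \<le> C * R powr (3/2)" unfolding R_def by (rule C(2))
    also have "(\<Sum>n\<in>bracket_ball R - ?N. ?f (b - n)) \<le> real (card (bracket_ball R - ?N)) * R powr (- 1/2)"
    proof (rule sum_bounded_above)
      fix n assume "n \<in> bracket_ball R - ?N"
      then have "R \<le> japanese_bracket (b - n)" by (auto simp: bracket_ball_def)
      then show "?f (b - n) \<le> R powr (- 1/2)" using R1 by (intro powr_mono2') auto
    qed
    also have "\<dots> \<le> (9 * R\<^sup>2) * R powr (- 1/2)"
    proof (rule mult_right_mono)
      have "real (card (bracket_ball R - ?N)) \<le> real (card (bracket_ball R))"
        by (simp add: card_mono finite_bracket_ball)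
      also have "\<dots> \<le> 9 * R\<^sup>2" using R1 by (rule card_bracket_ball_le)
      finally show "real (card (bracket_ball R - ?N)) \<le> 9 * R\<^sup>2" .
    qed simp
    also have "\<dots> = 9 * R powr (3/2)"
      using R1 powr_add[of R 2 "-1/2"] by simp
    finally show ?thesis by (simp add: R_def algebra_simps)
  qed
  then show ?thesis using C(1) by (intro exI[of _ "C + 9"]) auto
qed

section \<open>Clusters of lattice points in a unit annulus\<close>

text \<open>On the part of the annulus where the first coordinate dominates, the circle is never close to
  horizontal, so each horizontal line meets each of its two arcs in an interval of length less than 3.
  Hence the second coordinate together with the residue modulo 3 and the sign of the first
  one determines the point. The second coordinate takes at most \<open>D + 1\<close> values.\<close>

lemma card_annulus_flat:
  fixes E :: "(int \<times> int) set" and k :: int and D :: real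
  assumes fin: "finite E" and D: "0 \<le> D" and k: "1 \<le> k"
    and ann: "\<And>x. x \<in> E \<Longrightarrow> k\<^sup>2 \<le> 1 + (fst x)\<^sup>2 + (snd x)\<^sup>2 \<and> 1 + (fst x)\<^sup>2 + (snd x)\<^sup>2 < (k + 1)\<^sup>2"
    and flat: "\<And>x. x \<in> E \<Longrightarrow> \<bar>snd x\<bar> \<le> \<bar>fst x\<bar>"
    and close: "\<And>x y. x \<in> E \<Longrightarrow> y \<in> E \<Longrightarrow> real_of_int \<bar>snd x - snd y\<bar> \<le> D"
  shows "real (card E) \<le> 6 * (D + 1)"
proof (cases "E = {}")
  case True
  then show ?thesis using D by simp
next
  case False
  define h where "h = (\<lambda>x::int \<times> int. (snd x, fst x mod 3, 0 \<le> fst x))"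
  have no_gap: False if x: "x \<in> E" and y: "y \<in> E" and s: "snd x = snd y" and g: "\<bar>fst y\<bar> + 3 \<le> \<bar>fst x\<bar>" for x y
  proof -
    define u v w where "u = \<bar>fst x\<bar>" "v = \<bar>fst y\<bar>" "w = \<bar>snd y\<bar>"
    have uvw: "u \<ge> v + 3" "v \<ge> 0" "w \<ge> 0" "w \<le> v" using g flat[OF y] by (auto simp: u_v_w_def)
    have a1: "k\<^sup>2 \<le> 1 + v\<^sup>2 + w\<^sup>2" using ann[OF y] by (simp add: u_v_w_def)
    have a2: "1 + u\<^sup>2 + w\<^sup>2 < (k + 1)\<^sup>2" using ann[OF x] s by (simp add: u_v_w_def)
    have "(v + 3)\<^sup>2 \<le> u\<^sup>2" using uvw by (intro power_mono) auto
    then have "6 * v + 9 \<le> 2 * k" using a1 a2 by (simp add: power2_eq_square algebra_simps)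
    then have "3 * v + 4 \<le> k" by simp
    then have "(3 * v + 4)\<^sup>2 \<le> k\<^sup>2" using uvw by (intro power_mono) auto
    moreover have "w\<^sup>2 \<le> v\<^sup>2" using uvw by (intro power_mono) auto
    ultimately have "(3 * v + 4)\<^sup>2 \<le> 1 + 2 * v\<^sup>2" using a1 by linarith
    then have "7 * v\<^sup>2 + 24 * v + 15 \<le> 0" by (simp add: power2_eq_square algebra_simps)
    then show False using uvw(2) by (smt (verit) zero_le_power2)
  qed
  have inj: "inj_on h E"
  proof (rule inj_onI)
    fix x y assume x: "x \<in> E" and y: "y \<in> E" and "h x = h y"
    then have s: "snd x = snd y" and m: "fst x mod 3 = fst y mod 3" and p: "(0 \<le> fst x) = (0 \<le> fst y)"
      by (auto simp: h_def)
    have "\<not> \<bar>fst y\<bar> + 3 \<le> \<bar>fst x\<bar>" "\<not> \<bar>fst x\<bar> + 3 \<le> \<bar>fst y\<bar>"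
      using no_gap[OF x y s] no_gap[OF y x s[symmetric]] by auto
    then have "\<bar>fst x - fst y\<bar> < 3" using p by linarith
    then have "fst x = fst y" using m by presburger
    then show "x = y" using s by (simp add: prod_eq_iff)
  qed
  define c where "c = Min (snd ` E)"
  have cE: "c \<in> snd ` E" unfolding c_def using fin False by (intro Min_in) auto
  then obtain z where z: "z \<in> E" "c = snd z" by auto
  have "h ` E \<subseteq> {c..c + \<lfloor>D\<rfloor>} \<times> {0..2} \<times> UNIV"
  proof
    fix t assume "t \<in> h ` E"
    then obtain x where x: "x \<in> E" "t = h x" by auto
    have "c \<le> snd x" unfolding c_def using fin x by (intro Min_le) auto
    moreover have "snd x - c \<le> \<lfloor>D\<rfloor>" using close[OF x(1) z(1)] z(2) by (simp add: le_floor_iff)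
    ultimately show "t \<in> {c..c + \<lfloor>D\<rfloor>} \<times> {0..2} \<times> UNIV"
      using x(2) by (auto simp: h_def)
  qed
  then have "card (h ` E) \<le> card ({c..c + \<lfloor>D\<rfloor>} \<times> {0..2::int} \<times> (UNIV::bool set))"
    by (intro card_mono) auto
  then have "card E \<le> nat (\<lfloor>D\<rfloor> + 1) * 6"
    by (simp add: card_image[OF inj] card_cartesian_product)
  then have "real (card E) \<le> real (nat (\<lfloor>D\<rfloor> + 1)) * 6"
    by (metis of_nat_le_iff of_nat_mult of_nat_numeral)
  also have "real (nat (\<lfloor>D\<rfloor> + 1)) \<le> D + 1" using D by simp
  finally show ?thesis by simp
qed

text \<open>A cluster of diameter \<open>D\<close> in an annulus of unit width contains \<open>O(D + 1)\<close> lattice points, as if it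
  were a piece of curve of length \<open>D\<close>, whatever the radius.\<close>

lemma card_annulus_close:
  fixes E :: "(int \<times> int) set" and k :: int and D :: real
  assumes fin: "finite E" and D: "0 \<le> D" and k: "1 \<le> k"
    and ann: "\<And>x. x \<in> E \<Longrightarrow> real_of_int k \<le> japanese_bracket x \<and> japanese_bracket x < real_of_int k + 1"
    and close: "\<And>x y. x \<in> E \<Longrightarrow> y \<in> E \<Longrightarrow> lattice_norm (x - y) \<le> D"
  shows "real (card E) \<le> 12 * (D + 1)"
proof -
  have ann': "k\<^sup>2 \<le> 1 + (fst x)\<^sup>2 + (snd x)\<^sup>2 \<and> 1 + (fst x)\<^sup>2 + (snd x)\<^sup>2 < (k + 1)\<^sup>2" if "x \<in> E" for x
  proof -
    have "(real_of_int k)\<^sup>2 \<le> (japanese_bracket x)\<^sup>2" "(japanese_bracket x)\<^sup>2 < (real_of_int k + 1)\<^sup>2"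
      using ann[OF that] k by (auto intro!: power_mono power_strict_mono)
    then have "real_of_int (k\<^sup>2) \<le> real_of_int (1 + (fst x)\<^sup>2 + (snd x)\<^sup>2)"
      "real_of_int (1 + (fst x)\<^sup>2 + (snd x)\<^sup>2) < real_of_int ((k + 1)\<^sup>2)"
      by (simp_all add: japanese_bracket_sq)
    then show ?thesis by (simp only: of_int_le_iff of_int_less_iff)
  qed
  have coord: "real_of_int \<bar>fst x\<bar> \<le> lattice_norm x" "real_of_int \<bar>snd x\<bar> \<le> lattice_norm x" for x
    using norm_fst_le[of "real_of_int (fst x)" "real_of_int (snd x)"]
      norm_snd_le[of "real_of_int (snd x)" "real_of_int (fst x)"]
    by (simp_all add: lattice_norm_def)
  define E1 where "E1 = {x \<in> E. \<bar>snd x\<bar> \<le> \<bar>fst x\<bar>}"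
  define E2 where "E2 = {x \<in> E. \<bar>fst x\<bar> \<le> \<bar>snd x\<bar>}"
  have "real (card E1) \<le> 6 * (D + 1)"
  proof (rule card_annulus_flat[OF _ D k])
    show "real_of_int \<bar>snd x - snd y\<bar> \<le> D" if "x \<in> E1" "y \<in> E1" for x y
      using coord(2)[of "x - y"] close[of x y] that by (simp add: E1_def)
  qed (use fin ann' in \<open>auto simp: E1_def\<close>)
  moreover have "real (card (prod.swap ` E2)) \<le> 6 * (D + 1)"
  proof (rule card_annulus_flat[OF _ D k])
    show "real_of_int \<bar>snd x - snd y\<bar> \<le> D" if xy: "x \<in> prod.swap ` E2" "y \<in> prod.swap ` E2" for x y
    proof -
      have "prod.swap x \<in> E" "prod.swap y \<in> E" using xy by (auto simp: E2_def)
      from close[OF this] coord(1)[of "prod.swap x - prod.swap y"] show ?thesis by simp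
    qed
    show "k\<^sup>2 \<le> 1 + (fst x)\<^sup>2 + (snd x)\<^sup>2 \<and> 1 + (fst x)\<^sup>2 + (snd x)\<^sup>2 < (k + 1)\<^sup>2"
      if x: "x \<in> prod.swap ` E2" for x
    proof -
      have "prod.swap x \<in> E" using x by (auto simp: E2_def)
      from ann'[OF this] show ?thesis by (simp add: add_ac)
    qed
  qed (use fin in \<open>auto simp: E2_def\<close>)
  then have "real (card E2) \<le> 6 * (D + 1)" by (simp add: card_image)
  moreover have "E = E1 \<union> E2" by (auto simp: E1_def E2_def)
  then have "card E \<le> card E1 + card E2" by (simp add: card_Un_le)
  ultimately show ?thesis by linarith
qed

section \<open>Counting lattice points near an ellipse or hyperbola\<close>

text \<open>Write \<open>A\<close> for the length of \<open>a\<close>, \<open>Q\<close> for the bracket of \<open>x\<close> and \<open>P\<close> for that of \<open>a - x\<close>. Since \<open>Q\<close> is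
  known up to \<open>O(1)\<close>, so is \<open>P\<close> by resonance. The identity \<open>P\<^sup>2 = Q\<^sup>2 + A\<^sup>2 - 2 p\<close>, where \<open>p\<close> is the inner
  product of \<open>a\<close> and \<open>x\<close>, then fixes \<open>p\<close> up to \<open>O(K + A)\<close>. By the Lagrange identity
  \<open>p\<^sup>2 + q\<^sup>2 = A\<^sup>2 (Q\<^sup>2 - 1)\<close> the square of the cross product \<open>q\<close> is known as well, up to a controlled error. Two points on the
  same side of the line through \<open>a\<close> are therefore close, and their distance squared is at most of order
  \<open>K + K\<^sup>2 / A\<close>. The worst case is that of points nearly parallel to \<open>a\<close>, where \<open>q\<close> is only known up
  to the square root of the uncertainty of \<open>q\<^sup>2\<close>.\<close>

lemma resonant_points_same_side_close:
  fixes a x y :: "int \<times> int" and K \<mu> \<epsilon>1 \<epsilon>2 :: real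
  assumes eps: "\<epsilon>1 \<in> {1, -1}" "\<epsilon>2 \<in> {1, -1}"
    and xK: "K - 1 \<le> japanese_bracket x" "japanese_bracket x < K"
    and yK: "K - 1 \<le> japanese_bracket y" "japanese_bracket y < K"
    and x\<mu>: "\<bar>\<epsilon>1 * japanese_bracket (a - x) + \<epsilon>2 * japanese_bracket x - \<mu>\<bar> \<le> 1"
    and y\<mu>: "\<bar>\<epsilon>1 * japanese_bracket (a - y) + \<epsilon>2 * japanese_bracket y - \<mu>\<bar> \<le> 1"
    and side: "0 \<le> fst a * snd x - snd a * fst x \<longleftrightarrow> 0 \<le> fst a * snd y - snd a * fst y"
  shows "(lattice_norm a)\<^sup>2 * (lattice_norm (x - y))\<^sup>2
    \<le> 14 * K * (lattice_norm a)\<^sup>2 + 16 * K\<^sup>2 * lattice_norm a"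
proof -
  define A Q Q' P P' where "A = lattice_norm a" and "Q = japanese_bracket x" and "Q' = japanese_bracket y"
    and "P = japanese_bracket (a - x)" and "P' = japanese_bracket (a - y)"
  define a1 a2 x1 x2 y1 y2 where "a1 = real_of_int (fst a)" and "a2 = real_of_int (snd a)"
    and "x1 = real_of_int (fst x)" and "x2 = real_of_int (snd x)"
    and "y1 = real_of_int (fst y)" and "y2 = real_of_int (snd y)"
  note coord_defs = a1_def a2_def x1_def x2_def y1_def y2_def
  define p q p' q' where "p = a1 * x1 + a2 * x2" and "q = a1 * x2 - a2 * x1"
    and "p' = a1 * y1 + a2 * y2" and "q' = a1 * y2 - a2 * y1"
  have A0: "0 \<le> A" by (simp add: A_def lattice_norm_nonneg)
  have A2: "A\<^sup>2 = a1\<^sup>2 + a2\<^sup>2" by (simp add: A_def lattice_norm_sq coord_defs)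
  have Q2: "Q\<^sup>2 = 1 + x1\<^sup>2 + x2\<^sup>2" "Q'\<^sup>2 = 1 + y1\<^sup>2 + y2\<^sup>2"
    by (simp_all add: Q_def Q'_def japanese_bracket_sq coord_defs)
  have P2: "P\<^sup>2 = Q\<^sup>2 + A\<^sup>2 - 2 * p" "P'\<^sup>2 = Q'\<^sup>2 + A\<^sup>2 - 2 * p'"
    unfolding Q2 A2 p_def p'_def
    by (simp_all add: P_def P'_def japanese_bracket_sq coord_defs power2_diff algebra_simps)
  have pq: "p\<^sup>2 + q\<^sup>2 = A\<^sup>2 * (Q\<^sup>2 - 1)" "p'\<^sup>2 + q'\<^sup>2 = A\<^sup>2 * (Q'\<^sup>2 - 1)"
    unfolding Q2 A2 p_def p'_def q_def q'_def by algebra+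
  have dist: "(p - p')\<^sup>2 + (q - q')\<^sup>2 = A\<^sup>2 * (lattice_norm (x - y))\<^sup>2"
    unfolding lattice_norm_sq A2 p_def p'_def q_def q'_def
    by (simp add: coord_defs) algebra
  have Q01: "1 \<le> Q" "1 \<le> Q'" "1 \<le> P" "1 \<le> P'"
    by (simp_all add: Q_def Q'_def P_def P'_def japanese_bracket_ge_1)
  have QK: "K - 1 \<le> Q" "Q < K" "K - 1 \<le> Q'" "Q' < K" using xK yK by (simp_all add: Q_def Q'_def)
  have QQ: "\<bar>Q - Q'\<bar> \<le> 1" using QK by linarith
  have PP: "\<bar>P - P'\<bar> \<le> 3"
    using x\<mu> y\<mu> eps QQ by (fold Q_def Q'_def P_def P'_def) auto
  have PK: "P \<le> K + A" "P' \<le> K + A"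
  proof -
    have "japanese_bracket (a - z) \<le> japanese_bracket z + A" for z
      using japanese_bracket_triangle[of "- z" a]
      by (simp add: A_def japanese_bracket_def lattice_norm_uminus)
    from this[of x] this[of y] show "P \<le> K + A" "P' \<le> K + A"
      using QK by (simp_all add: P_def P'_def Q_def Q'_def)
  qed
  have dQ: "\<bar>Q\<^sup>2 - Q'\<^sup>2\<bar> \<le> 2 * K"
  proof -
    have "\<bar>Q\<^sup>2 - Q'\<^sup>2\<bar> = \<bar>Q - Q'\<bar> * (Q + Q')"
      using Q01 by (simp add: power2_eq_square square_diff_square_factored abs_mult)
    also have "\<dots> \<le> 1 * (2 * K)" using QQ QK Q01 by (intro mult_mono) auto
    finally show ?thesis by simp
  qed
  have dP: "\<bar>P\<^sup>2 - P'\<^sup>2\<bar> \<le> 6 * (K + A)"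
  proof -
    have "\<bar>P\<^sup>2 - P'\<^sup>2\<bar> = \<bar>P - P'\<bar> * (P + P')"
      using Q01 by (simp add: power2_eq_square square_diff_square_factored abs_mult)
    also have "\<dots> \<le> 3 * (2 * (K + A))" using PP PK Q01 by (intro mult_mono) auto
    finally show ?thesis by simp
  qed
  have dp: "\<bar>p - p'\<bar> \<le> 4 * K + 3 * A" using P2 dQ dP unfolding abs_le_iff by auto
  have pA: "\<bar>p\<bar> \<le> A * K" "\<bar>p'\<bar> \<le> A * K"
  proof -
    have "\<bar>p\<bar>\<^sup>2 \<le> (A * Q)\<^sup>2" "\<bar>p'\<bar>\<^sup>2 \<le> (A * Q')\<^sup>2"
      using pq zero_le_power2[of q] zero_le_power2[of q'] zero_le_power2[of A]
      unfolding power_mult_distrib power2_abs right_diff_distrib by linarith+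
    then have "\<bar>p\<bar> \<le> A * Q" "\<bar>p'\<bar> \<le> A * Q'"
      using A0 Q01 by (auto intro: power2_le_imp_le)
    moreover have "A * Q \<le> A * K" "A * Q' \<le> A * K" using A0 QK by (auto intro: mult_left_mono)
    ultimately show "\<bar>p\<bar> \<le> A * K" "\<bar>p'\<bar> \<le> A * K" by linarith+
  qed
  let ?B = "(4 * K + 3 * A) * (2 * (A * K))"
  have "(p - p')\<^sup>2 = \<bar>p - p'\<bar> * \<bar>p - p'\<bar>" by (simp add: power2_eq_square)
  also have "\<dots> \<le> ?B" using dp pA A0 by (intro mult_mono) auto
  finally have sp: "(p - p')\<^sup>2 \<le> ?B" .
  have "\<bar>p\<^sup>2 - p'\<^sup>2\<bar> = \<bar>p - p'\<bar> * \<bar>p + p'\<bar>"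
    by (simp add: power2_eq_square square_diff_square_factored abs_mult)
  also have "\<dots> \<le> ?B" using dp pA A0 by (intro mult_mono) auto
  finally have dpp: "\<bar>p\<^sup>2 - p'\<^sup>2\<bar> \<le> ?B" .
  have "q\<^sup>2 - q'\<^sup>2 = A\<^sup>2 * (Q\<^sup>2 - Q'\<^sup>2) - (p\<^sup>2 - p'\<^sup>2)" using pq by (simp add: algebra_simps)
  moreover have "\<bar>A\<^sup>2 * (Q\<^sup>2 - Q'\<^sup>2)\<bar> \<le> A\<^sup>2 * (2 * K)"
    using dQ by (simp add: abs_mult mult_left_mono)
  ultimately have dqq: "\<bar>q\<^sup>2 - q'\<^sup>2\<bar> \<le> A\<^sup>2 * (2 * K) + ?B" using dpp by linarith
  \<comment> \<open>This is where the two points have to lie on the same side of the line through \<open>a\<close>: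
    then \<open>\<bar>q - q'\<bar> \<le> \<bar>q + q'\<bar>\<close>, so closeness of the squares gives closeness of \<open>q\<close> and \<open>q'\<close>.\<close>
  have qi: "q = real_of_int (fst a * snd x - snd a * fst x)" "q' = real_of_int (fst a * snd y - snd a * fst y)"
    by (simp_all add: q_def q'_def coord_defs)
  have "0 \<le> q \<longleftrightarrow> 0 \<le> q'" unfolding qi of_int_0_le_iff by (rule side)
  then have "\<bar>q - q'\<bar> \<le> \<bar>q + q'\<bar>" by linarith
  then have "\<bar>q - q'\<bar> * \<bar>q - q'\<bar> \<le> \<bar>q - q'\<bar> * \<bar>q + q'\<bar>" by (intro mult_left_mono) auto
  then have "(q - q')\<^sup>2 \<le> \<bar>q\<^sup>2 - q'\<^sup>2\<bar>"
    by (simp add: power2_eq_square square_diff_square_factored abs_mult mult.commute)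
  with dist sp dqq have "A\<^sup>2 * (lattice_norm (x - y))\<^sup>2 \<le> A\<^sup>2 * (2 * K) + 2 * ?B" by linarith
  also have "\<dots> = 14 * K * A\<^sup>2 + 16 * K\<^sup>2 * A" by (simp add: power2_eq_square algebra_simps)
  finally show ?thesis by (simp add: A_def)
qed

text \<open>On each side of the line through \<open>a\<close> the resonant points of the shell form a cluster of diameter \<open>D\<close>,
  and a cluster of diameter \<open>D\<close> has \<open>O(D + 1)\<close> points.\<close>

lemma card_resonant_unit_shell:
  fixes a :: "int \<times> int" and \<mu> \<epsilon>1 \<epsilon>2 :: real and k :: int
  assumes eps: "\<epsilon>1 \<in> {1, -1}" "\<epsilon>2 \<in> {1, -1}" and a: "a \<noteq> 0" and k: "1 \<le> k"
  shows "real (card {x. real_of_int k \<le> japanese_bracket x \<and> japanese_bracket x < real_of_int k + 1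
      \<and> \<bar>\<epsilon>1 * japanese_bracket (a - x) + \<epsilon>2 * japanese_bracket x - \<mu>\<bar> \<le> 1})
    \<le> 120 * (sqrt (real_of_int k + 1) + (real_of_int k + 1) / sqrt (lattice_norm a))"
proof -
  define K where "K = real_of_int k + 1"
  define A where "A = lattice_norm a"
  have A1: "1 \<le> A" unfolding A_def by (rule lattice_norm_ge_1[OF a])
  have K2: "2 \<le> K" using k by (simp add: K_def)
  define S where "S = {x. real_of_int k \<le> japanese_bracket x \<and> japanese_bracket x < K
      \<and> \<bar>\<epsilon>1 * japanese_bracket (a - x) + \<epsilon>2 * japanese_bracket x - \<mu>\<bar> \<le> 1}"
  have finS: "finite S"
    by (rule finite_subset[OF _ finite_bracket_ball[of K]]) (auto simp: S_def bracket_ball_def)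
  define H where "H = (\<lambda>b. {x \<in> S. (0 \<le> fst a * snd x - snd a * fst x) = b})"
  define D where "D = 4 * (sqrt K + K / sqrt A)"
  have D0: "0 \<le> D" using K2 A1 by (simp add: D_def)
  have card_H: "real (card (H b)) \<le> 12 * (D + 1)" for b
  proof (rule card_annulus_close[OF _ D0 k])
    show "finite (H b)" using finS by (simp add: H_def)
    show "real_of_int k \<le> japanese_bracket x \<and> japanese_bracket x < real_of_int k + 1" if "x \<in> H b" for x
      using that by (simp add: H_def S_def K_def)
    show "lattice_norm (x - y) \<le> D" if x: "x \<in> H b" and y: "y \<in> H b" for x y
    proof -
      have "A\<^sup>2 * (lattice_norm (x - y))\<^sup>2 \<le> 14 * K * A\<^sup>2 + 16 * K\<^sup>2 * A"
        unfolding A_def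
        by (rule resonant_points_same_side_close[OF eps, where \<mu> = \<mu>])
          (use x y in \<open>auto simp: H_def S_def K_def\<close>)
      also have "\<dots> = A\<^sup>2 * (14 * K + 16 * K\<^sup>2 / A)"
        using A1 by (simp add: power2_eq_square field_simps)
      finally have "(lattice_norm (x - y))\<^sup>2 \<le> 14 * K + 16 * K\<^sup>2 / A" using A1 by simp
      also have "\<dots> \<le> D\<^sup>2"
      proof -
        have "D\<^sup>2 = 16 * (K + 2 * (sqrt K * (K / sqrt A)) + K\<^sup>2 / A)"
          unfolding D_def power_mult_distrib power2_sum using K2 A1 by (simp add: power_divide)
        moreover have "0 \<le> sqrt K * (K / sqrt A)" using K2 A1 by simp
        ultimately show ?thesis using K2 by simp
      qed
      finally show ?thesis using D0 by (rule power2_le_imp_le)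
    qed
  qed
  have "S = H True \<union> H False" by (auto simp: H_def)
  then have "card S \<le> card (H True) + card (H False)" by (simp add: card_Un_le)
  then have "real (card S) \<le> 24 * (D + 1)" using card_H[of True] card_H[of False] by linarith
  also have "\<dots> \<le> 120 * (sqrt K + K / sqrt A)"
  proof -
    define t where "t = sqrt K + K / sqrt A"
    have "1 \<le> sqrt K" "0 \<le> K / sqrt A" using K2 A1 by simp_all
    then have "1 \<le> t" unfolding t_def by linarith
    then show ?thesis unfolding D_def t_def[symmetric] by simp
  qed
  finally show ?thesis by (simp add: S_def K_def A_def)
qed

text \<open>The counting estimate behind the whole argument: for a given \<open>a\<close>, the resonance condition saves a
  factor of \<open>min R (japanese_bracket a) powr (1/2)\<close> over the trivial count \<open>R\<^sup>2\<close>. It follows by summing the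
  bound for unit shells over the \<open>O(R)\<close> shells in the ball. For \<open>a = 0\<close> the bound is the
  trivial one.\<close>

lemma card_resonant_ball:
  fixes a :: "int \<times> int" and \<mu> \<epsilon>1 \<epsilon>2 R :: real
  assumes eps: "\<epsilon>1 \<in> {1, -1}" "\<epsilon>2 \<in> {1, -1}" and R: "1 \<le> R"
  shows "real (card {x \<in> bracket_ball R. \<bar>\<epsilon>1 * japanese_bracket (a - x) + \<epsilon>2 * japanese_bracket x - \<mu>\<bar> \<le> 1})
    \<le> 360 * (R powr (3/2) + R\<^sup>2 * japanese_bracket a powr (- 1/2))"
    (is "real (card ?S) \<le> _")
proof (cases "a = 0")
  case True
  have "card ?S \<le> card (bracket_ball R)" by (intro card_mono finite_bracket_ball) auto
  then have "real (card ?S) \<le> 9 * R\<^sup>2" using card_bracket_ball_le[OF R] by linarith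
  also have "9 * R\<^sup>2 \<le> 360 * (R powr (3/2) + R\<^sup>2)"
    using powr_ge_zero[of R "3/2"] zero_le_power2[of R] by (simp add: distrib_left)
  finally show ?thesis by (simp add: True japanese_bracket_def lattice_norm_def)
next
  case False
  define A where "A = lattice_norm a"
  have A1: "1 \<le> A" unfolding A_def by (rule lattice_norm_ge_1[OF False])
  define T where "T = (\<lambda>k::int. {x. real_of_int k \<le> japanese_bracket x \<and> japanese_bracket x < real_of_int k + 1
      \<and> \<bar>\<epsilon>1 * japanese_bracket (a - x) + \<epsilon>2 * japanese_bracket x - \<mu>\<bar> \<le> 1})"
  define b where "b = 240 * (sqrt R + R / sqrt A)"
  have Tb: "real (card (T k)) \<le> b" if k: "k \<in> {1..\<lfloor>R\<rfloor>}" for k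
  proof -
    have kR: "1 \<le> k" "real_of_int k + 1 \<le> 4 * R" "real_of_int k + 1 \<le> 2 * R" using k R by (auto simp: le_floor_iff)
    have "real (card (T k)) \<le> 120 * (sqrt (real_of_int k + 1) + (real_of_int k + 1) / sqrt A)"
      unfolding T_def A_def by (rule card_resonant_unit_shell[OF eps False kR(1)])
    also have "\<dots> \<le> 120 * (2 * sqrt R + 2 * R / sqrt A)"
    proof -
      have "sqrt (real_of_int k + 1) \<le> 2 * sqrt R"
        using real_sqrt_le_mono[OF kR(2)] by (simp add: real_sqrt_mult)
      moreover have "(real_of_int k + 1) / sqrt A \<le> 2 * R / sqrt A"
        using kR(3) A1 by (intro divide_right_mono) auto
      ultimately show ?thesis by (intro mult_left_mono add_mono) auto
    qed
    finally show ?thesis by (simp add: b_def)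
  qed
  have finT: "finite (T k)" for k
    by (rule finite_subset[OF _ finite_bracket_ball[of "real_of_int k + 1"]]) (auto simp: T_def bracket_ball_def)
  have "?S \<subseteq> (\<Union>k\<in>{1..\<lfloor>R\<rfloor>}. T k)"
  proof
    fix x assume x: "x \<in> ?S"
    have "\<lfloor>japanese_bracket x\<rfloor> \<in> {1..\<lfloor>R\<rfloor>}"
      using x japanese_bracket_ge_1[of x] by (simp add: bracket_ball_def floor_mono)
    moreover have "x \<in> T \<lfloor>japanese_bracket x\<rfloor>" using x by (simp add: T_def)
    ultimately show "x \<in> (\<Union>k\<in>{1..\<lfloor>R\<rfloor>}. T k)" by blast
  qed
  then have "card ?S \<le> card (\<Union>k\<in>{1..\<lfloor>R\<rfloor>}. T k)" by (intro card_mono finite_UN_I finT) simp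
  also have "\<dots> \<le> (\<Sum>k\<in>{1..\<lfloor>R\<rfloor>}. card (T k))" by (intro card_UN_le) simp
  finally have "real (card ?S) \<le> real (\<Sum>k\<in>{1..\<lfloor>R\<rfloor>}. card (T k))" by (rule of_nat_mono)
  also have "\<dots> = (\<Sum>k\<in>{1..\<lfloor>R\<rfloor>}. real (card (T k)))" by (rule of_nat_sum)
  also have "\<dots> \<le> real (card {1..\<lfloor>R\<rfloor>}) * b" by (intro sum_bounded_above Tb)
  also have "\<dots> \<le> R * b"
  proof (rule mult_right_mono)
    show "real (card {1..\<lfloor>R\<rfloor>}) \<le> R" using R by simp
    show "0 \<le> b" using R A1 by (simp add: b_def)
  qed
  also have "\<dots> = 240 * (R * sqrt R) + 240 * (R\<^sup>2 * (1 / sqrt A))"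
    by (simp add: b_def power2_eq_square algebra_simps)
  also have "\<dots> \<le> 240 * (R * sqrt R) + 240 * (R\<^sup>2 * (3/2 * japanese_bracket a powr (- 1/2)))"
  proof -
    \<comment> \<open>The sharp constant is \<open>sqrt 2\<close>; \<open>9/4\<close> is a larger number with a rational square root.\<close>
    have "japanese_bracket a \<le> (3/2)\<^sup>2 * A"
    proof -
      have "1 \<le> A\<^sup>2" using power_mono[OF A1, of 2] by simp
      then have "(japanese_bracket a)\<^sup>2 \<le> (9/4 * A)\<^sup>2"
        by (simp add: japanese_bracket_def A_def power_mult_distrib power_divide)
      then have "japanese_bracket a \<le> 9/4 * A" by (rule power2_le_imp_le) (use A1 in simp)
      then show ?thesis by (simp add: power_divide)
    qed
    then have "sqrt (japanese_bracket a) \<le> sqrt ((3/2)\<^sup>2 * A)" by (rule real_sqrt_le_mono)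
    also have "\<dots> = 3/2 * sqrt A" by (simp add: real_sqrt_mult)
    finally have "sqrt (japanese_bracket a) \<le> 3/2 * sqrt A" .
    then have "1 / sqrt A \<le> 3/2 * (1 / sqrt (japanese_bracket a))"
      using A1 japanese_bracket_pos[of a] by (simp add: field_simps)
    also have "1 / sqrt (japanese_bracket a) = japanese_bracket a powr (- 1/2)"
      using japanese_bracket_pos[of a] by (simp add: powr_minus_divide powr_half_sqrt)
    finally show ?thesis by (intro add_left_mono mult_left_mono) auto
  qed
  also have "R * sqrt R = R powr (3/2)"
  proof -
    have "R powr (3/2) = R powr (1 + 1/2)" by simp
    also have "\<dots> = R * sqrt R" using R unfolding powr_add by (simp add: powr_half_sqrt)
    finally show ?thesis by simp
  qed
  also have "240 * R powr (3/2) + 240 * (R\<^sup>2 * (3/2 * japanese_bracket a powr (- 1/2)))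
      \<le> 360 * (R powr (3/2) + R\<^sup>2 * japanese_bracket a powr (- 1/2))"
    using powr_ge_zero[of R "3/2"] by (simp add: algebra_simps)
  finally show ?thesis .
qed

section \<open>Summing over resonant triples\<close>

definition dyadic_shell :: "real \<Rightarrow> (int \<times> int) set" where
  "dyadic_shell N = {n. size_comparable n N}"

lemma dyadic_shell_subset_ball: "1 \<le> N \<Longrightarrow> dyadic_shell N \<subseteq> bracket_ball (4 * N)"
proof
  fix n assume "1 \<le> N" "n \<in> dyadic_shell N"
  then show "n \<in> bracket_ball (4 * N)"
    using japanese_bracket_le_lattice_norm[of n]
    by (simp add: dyadic_shell_def size_comparable_def bracket_ball_def)
qed

lemma finite_dyadic_shell: "1 \<le> N \<Longrightarrow> finite (dyadic_shell N)"
  using dyadic_shell_subset_ball finite_bracket_ball by (rule finite_subset)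

lemma dyadic_ge_1: "dyadic N \<Longrightarrow> 1 \<le> N"
  by (auto simp: dyadic_def)

lemma weight_on_dyadic_shell:
  assumes "n \<in> dyadic_shell N" "1 \<le> N" "0 < \<alpha>" "\<alpha> < 1"
  shows "japanese_bracket n powr (-2 + 2 * \<alpha>) \<le> 4 * N powr (-2 + 2 * \<alpha>)"
proof -
  have "N / 2 \<le> japanese_bracket n"
    using assms(1) lattice_norm_le_japanese_bracket[of n]
    by (simp add: dyadic_shell_def size_comparable_def)
  then have "japanese_bracket n powr (-2 + 2 * \<alpha>) \<le> (N / 2) powr (-2 + 2 * \<alpha>)"
    using assms by (intro powr_mono2') auto
  also have "\<dots> = N powr (-2 + 2 * \<alpha>) * 2 powr (2 - 2 * \<alpha>)"
    using assms powr_minus_divide[of 2 "-2 + 2 * \<alpha>"] by (simp add: powr_divide)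
  also have "\<dots> \<le> N powr (-2 + 2 * \<alpha>) * 2 powr 2"
    using assms by (intro mult_left_mono powr_mono) auto
  finally show ?thesis by (simp add: mult.commute)
qed

text \<open>The variables are \<open>n0 = n1 + n2 + n3\<close>, \<open>n3\<close> and \<open>n2\<close> instead of \<open>n1\<close>, \<open>n2\<close> and \<open>n3\<close>. With \<open>n0\<close> and \<open>n3\<close>
  held fixed, \<open>n1 + n2 = n0 - n3\<close> is fixed, and the resonance condition involves \<open>n2\<close> through
  \<open>japanese_bracket (n0 - n3 - n2)\<close> and \<open>japanese_bracket n2\<close> only, which is the situation of
  \<open>card_resonant_ball\<close>. The sum over \<open>n3\<close> averages the gain over \<open>n0 - n3\<close>, and
  the hypothesis \<open>0 < s\<close> makes the sum over \<open>n0\<close> of order \<open>N1 powr (2 * s)\<close>.\<close>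

lemma sum_resonant_triples_le:
  fixes s :: real
  assumes s: "0 < s"
  shows "\<exists>C>0. \<forall>\<sigma> \<sigma>1 \<sigma>2 \<sigma>3 \<mu> N1 N2 N3. \<sigma>1 \<in> {1, -1} \<longrightarrow> \<sigma>2 \<in> {1, -1} \<longrightarrow>
      dyadic N1 \<longrightarrow> dyadic N2 \<longrightarrow> dyadic N3 \<longrightarrow> N3 \<le> N2 \<longrightarrow> N2 \<le> N1 \<longrightarrow>
      (\<Sum>n3\<in>dyadic_shell N3. \<Sum>n2\<in>dyadic_shell N2. \<Sum>n1\<in>dyadic_shell N1.
        japanese_bracket (n1 + n2 + n3) powr (2 * (s - 1))
          * of_bool (\<bar>phase \<sigma> \<sigma>1 \<sigma>2 \<sigma>3 n1 n2 n3 - \<mu>\<bar> \<le> 1))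
      \<le> C * (N1 powr (2 * s) * N2\<^sup>2 * N3 powr (3/2))"
proof -
  obtain C0 where C0: "C0 > 0" "\<And>k::nat. (\<Sum>n\<in>bracket_ball (2 ^ k). japanese_bracket n powr (2 * (s - 1))) \<le> C0 * (2 ^ k) powr (2 * s)"
    using sum_bracket_powr_ball[of "2 * s"] s by (auto simp: right_diff_distrib)
  obtain C1 where C1: "C1 > 0" "\<And>b. \<And>k::nat. (\<Sum>n\<in>bracket_ball (2 ^ k). japanese_bracket (b - n) powr (- 1/2)) \<le> C1 * (2 ^ k) powr (3/2)"
    using sum_bracket_translate_ball by blast
  define C where "C = C0 * 8 powr (2 * s) * (360 * (9 + C1) * (16 * 4 powr (3/2)))"
  have "C > 0" using C0 C1 by (simp add: C_def)
  moreover have "(\<Sum>n3\<in>dyadic_shell N3. \<Sum>n2\<in>dyadic_shell N2. \<Sum>n1\<in>dyadic_shell N1.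
        japanese_bracket (n1 + n2 + n3) powr (2 * (s - 1))
          * of_bool (\<bar>phase \<sigma> \<sigma>1 \<sigma>2 \<sigma>3 n1 n2 n3 - \<mu>\<bar> \<le> 1))
      \<le> C * (N1 powr (2 * s) * N2\<^sup>2 * N3 powr (3/2))"
    if eps: "\<sigma>1 \<in> {1, -1}" "\<sigma>2 \<in> {1, -1}" and dy: "dyadic N1" "dyadic N2" "dyadic N3"
      and ord: "N3 \<le> N2" "N2 \<le> N1" for \<sigma> \<sigma>1 \<sigma>2 \<sigma>3 \<mu> N1 N2 N3
  proof -
    have N: "1 \<le> N1" "1 \<le> N2" "1 \<le> N3" using dy by (auto dest: dyadic_ge_1)
    define R1 R2 R3 where "R1 = 8 * N1" and "R2 = 4 * N2" and "R3 = 4 * N3"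
    have R: "1 \<le> R2" "1 \<le> R3" "R3 \<le> R2" using N ord by (auto simp: R2_def R3_def)
    \<comment> \<open>The factors 8 and 4 are large enough for the shells and their sums to lie in the balls, and
      powers of two so that the radii stay dyadic.\<close>
    obtain k1 where k1: "R1 = 2 ^ k1"
    proof -
      obtain k where "N1 = 2 ^ k" using dy by (auto simp: dyadic_def)
      then have "R1 = 2 ^ (k + 3)" by (simp add: R1_def power_add)
      then show ?thesis by (rule that)
    qed
    obtain k3 where k3: "R3 = 2 ^ k3"
    proof -
      obtain k where "N3 = 2 ^ k" using dy by (auto simp: dyadic_def)
      then have "R3 = 2 ^ (k + 2)" by (simp add: R3_def power_add)
      then show ?thesis by (rule that)
    qed
    define f where "f = (\<lambda>n0. japanese_bracket n0 powr (2 * (s - 1)))"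
    define I where "I = (\<lambda>n0 n3 n2. of_bool (\<bar>\<sigma>1 * japanese_bracket (n0 - n3 - n2) + \<sigma>2 * japanese_bracket n2
        - (\<mu> - \<sigma> * japanese_bracket n0 - \<sigma>3 * japanese_bracket n3)\<bar> \<le> 1) :: real)"
    have fI0: "0 \<le> f n0 * I n0 n3 n2" for n0 n3 n2 by (simp add: f_def I_def)
    have inner: "(\<Sum>n1\<in>dyadic_shell N1. japanese_bracket (n1 + n2 + n3) powr (2 * (s - 1))
          * of_bool (\<bar>phase \<sigma> \<sigma>1 \<sigma>2 \<sigma>3 n1 n2 n3 - \<mu>\<bar> \<le> 1))
        \<le> (\<Sum>n0\<in>bracket_ball R1. f n0 * I n0 n3 n2)"
      if n2: "n2 \<in> dyadic_shell N2" and n3: "n3 \<in> dyadic_shell N3" for n2 n3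
    proof -
      have "(\<Sum>n1\<in>dyadic_shell N1. japanese_bracket (n1 + n2 + n3) powr (2 * (s - 1))
          * of_bool (\<bar>phase \<sigma> \<sigma>1 \<sigma>2 \<sigma>3 n1 n2 n3 - \<mu>\<bar> \<le> 1))
          = (\<Sum>n1\<in>dyadic_shell N1. f (n1 + n2 + n3) * I (n1 + n2 + n3) n3 n2)"
        by (simp add: f_def I_def phase_def algebra_simps)
      also have "\<dots> = (\<Sum>n0\<in>(\<lambda>n1. n1 + n2 + n3) ` dyadic_shell N1. f n0 * I n0 n3 n2)"
        by (subst sum.reindex) (auto simp: inj_on_def)
      also have "\<dots> \<le> (\<Sum>n0\<in>bracket_ball R1. f n0 * I n0 n3 n2)"
      proof (rule sum_mono2[OF finite_bracket_ball _ fI0])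
        show "(\<lambda>n1. n1 + n2 + n3) ` dyadic_shell N1 \<subseteq> bracket_ball R1"
        proof (rule image_subsetI)
          fix n1 assume n1: "n1 \<in> dyadic_shell N1"
          have "lattice_norm (n1 + n2 + n3) \<le> lattice_norm n1 + lattice_norm n2 + lattice_norm n3"
            using lattice_norm_triangle[of "n1 + n2" n3] lattice_norm_triangle[of n1 n2] by linarith
          moreover have "lattice_norm n1 \<le> 2 * N1" "lattice_norm n2 \<le> 2 * N2" "lattice_norm n3 \<le> 2 * N3"
            using n1 n2 n3 by (auto simp: dyadic_shell_def size_comparable_def)
          ultimately show "n1 + n2 + n3 \<in> bracket_ball R1"
            using japanese_bracket_le_lattice_norm[of "n1 + n2 + n3"] ord N
            by (simp add: bracket_ball_def R1_def)
        qed
      qed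
      finally show ?thesis .
    qed
    have count: "(\<Sum>n3\<in>bracket_ball R3. \<Sum>n2\<in>bracket_ball R2. I n0 n3 n2)
        \<le> 360 * (9 + C1) * (R2\<^sup>2 * R3 powr (3/2))" for n0
    proof -
      have "(\<Sum>n2\<in>bracket_ball R2. I n0 n3 n2)
          \<le> 360 * (R2 powr (3/2) + R2\<^sup>2 * japanese_bracket (n0 - n3) powr (- 1/2))" for n3
        using card_resonant_ball[OF eps R(1), of "n0 - n3" "\<mu> - \<sigma> * japanese_bracket n0 - \<sigma>3 * japanese_bracket n3"]
        by (simp add: I_def finite_bracket_ball sum.If_cases of_bool_def Int_def)
      then have "(\<Sum>n3\<in>bracket_ball R3. \<Sum>n2\<in>bracket_ball R2. I n0 n3 n2)
          \<le> (\<Sum>n3\<in>bracket_ball R3. 360 * (R2 powr (3/2) + R2\<^sup>2 * japanese_bracket (n0 - n3) powr (- 1/2)))"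
        by (intro sum_mono)
      also have "\<dots> = 360 * (real (card (bracket_ball R3)) * R2 powr (3/2)
          + R2\<^sup>2 * (\<Sum>n3\<in>bracket_ball R3. japanese_bracket (n0 - n3) powr (- 1/2)))"
        by (simp add: sum_distrib_left[symmetric] sum.distrib)
      also have "\<dots> \<le> 360 * ((9 * R3\<^sup>2) * R2 powr (3/2) + R2\<^sup>2 * (C1 * R3 powr (3/2)))"
        using C1(2)[of n0 k3] card_bracket_ball_le[OF R(2)]
        by (intro mult_left_mono add_mono mult_right_mono) (auto simp: k3)
      also have "\<dots> = 360 * (9 * (R3\<^sup>2 * R2 powr (3/2)) + R2\<^sup>2 * (C1 * R3 powr (3/2)))"
        by (simp only: mult.assoc)
      \<comment> \<open>This is where the ordering \<open>R3 \<le> R2\<close> enters: the part of the count that does not decay in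
        \<open>n0 - n3\<close> is dominated by the part that does.\<close>
      also have "R3\<^sup>2 * R2 powr (3/2) \<le> R2\<^sup>2 * R3 powr (3/2)"
      proof -
        have split: "x\<^sup>2 = x powr (3/2) * x powr (1/2)" if "1 \<le> x" for x :: real
          using that by (simp add: powr_add[symmetric])
        have "R3 powr (1/2) \<le> R2 powr (1/2)" using R by (intro powr_mono2) auto
        then show ?thesis using R unfolding split[OF R(1)] split[OF R(2)]
          by (simp add: mult_left_mono mult.commute mult.left_commute)
      qed
      finally show ?thesis by (simp add: algebra_simps)
    qed
    have "(\<Sum>n3\<in>dyadic_shell N3. \<Sum>n2\<in>dyadic_shell N2. \<Sum>n1\<in>dyadic_shell N1.
        japanese_bracket (n1 + n2 + n3) powr (2 * (s - 1))
          * of_bool (\<bar>phase \<sigma> \<sigma>1 \<sigma>2 \<sigma>3 n1 n2 n3 - \<mu>\<bar> \<le> 1))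
        \<le> (\<Sum>n3\<in>dyadic_shell N3. \<Sum>n2\<in>dyadic_shell N2. \<Sum>n0\<in>bracket_ball R1. f n0 * I n0 n3 n2)"
      by (intro sum_mono inner)
    also have "\<dots> \<le> (\<Sum>n3\<in>dyadic_shell N3. \<Sum>n2\<in>bracket_ball R2. \<Sum>n0\<in>bracket_ball R1. f n0 * I n0 n3 n2)"
      using dyadic_shell_subset_ball[OF N(2)]
      by (intro sum_mono sum_mono2 sum_nonneg fI0 finite_bracket_ball) (auto simp: R2_def)
    also have "\<dots> \<le> (\<Sum>n3\<in>bracket_ball R3. \<Sum>n2\<in>bracket_ball R2. \<Sum>n0\<in>bracket_ball R1. f n0 * I n0 n3 n2)"
      using dyadic_shell_subset_ball[OF N(3)]
      by (intro sum_mono2 sum_nonneg fI0 finite_bracket_ball) (auto simp: R3_def)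
    also have "\<dots> = (\<Sum>n3\<in>bracket_ball R3. \<Sum>n0\<in>bracket_ball R1. \<Sum>n2\<in>bracket_ball R2. f n0 * I n0 n3 n2)"
      by (rule sum.cong[OF refl sum.swap])
    also have "\<dots> = (\<Sum>n0\<in>bracket_ball R1. \<Sum>n3\<in>bracket_ball R3. \<Sum>n2\<in>bracket_ball R2. f n0 * I n0 n3 n2)"
      by (rule sum.swap)
    also have "\<dots> = (\<Sum>n0\<in>bracket_ball R1. f n0 * (\<Sum>n3\<in>bracket_ball R3. \<Sum>n2\<in>bracket_ball R2. I n0 n3 n2))"
      by (simp add: sum_distrib_left)
    also have "\<dots> \<le> (\<Sum>n0\<in>bracket_ball R1. f n0 * (360 * (9 + C1) * (R2\<^sup>2 * R3 powr (3/2))))"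
      by (intro sum_mono mult_left_mono count) (simp add: f_def)
    also have "\<dots> = (\<Sum>n0\<in>bracket_ball R1. f n0) * (360 * (9 + C1) * (R2\<^sup>2 * R3 powr (3/2)))"
      by (simp add: sum_distrib_right)
    also have "\<dots> \<le> (C0 * R1 powr (2 * s)) * (360 * (9 + C1) * (R2\<^sup>2 * R3 powr (3/2)))"
      using C0(2)[of k1] C1(1) by (intro mult_right_mono) (auto simp: f_def k1)
    also have "\<dots> = C * (N1 powr (2 * s) * N2\<^sup>2 * N3 powr (3/2))"
      using N by (simp add: C_def R1_def R2_def R3_def powr_mult power_mult_distrib)
    finally show ?thesis .
  qed
  ultimately show ?thesis by blast
qed

text \<open>The left-hand side of the estimate for one value \<open>\<mu>\<close> of the phase, as a sum over finite sets. The signs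
  are placed next to the frequency scales so that both can be permuted together.\<close>

definition resonant_sum :: "real \<Rightarrow> real \<Rightarrow> real \<Rightarrow> real \<Rightarrow> real \<Rightarrow> real \<Rightarrow> real \<Rightarrow> real \<Rightarrow> real \<Rightarrow> real \<Rightarrow> real" where
  "resonant_sum \<alpha> s \<sigma> \<mu> \<sigma>1 \<sigma>2 \<sigma>3 N1 N2 N3 =
    (\<Sum>n1\<in>dyadic_shell N1. \<Sum>n2\<in>dyadic_shell N2. \<Sum>n3\<in>dyadic_shell N3.
      japanese_bracket (n1 + n2 + n3) powr (2 * (s - 1))
      * (japanese_bracket n1 powr (-2 + 2 * \<alpha>) * japanese_bracket n2 powr (-2 + 2 * \<alpha>)
        * japanese_bracket n3 powr (-2 + 2 * \<alpha>))
      * of_bool (\<bar>phase \<sigma> \<sigma>1 \<sigma>2 \<sigma>3 n1 n2 n3 - \<mu>\<bar> \<le> 1))"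

lemma resonant_sum_swap12:
  "resonant_sum \<alpha> s \<sigma> \<mu> \<sigma>1 \<sigma>2 \<sigma>3 N1 N2 N3 = resonant_sum \<alpha> s \<sigma> \<mu> \<sigma>2 \<sigma>1 \<sigma>3 N2 N1 N3"
  unfolding resonant_sum_def
  by (subst sum.swap) (simp add: phase_def add_ac mult_ac)

lemma resonant_sum_swap23:
  "resonant_sum \<alpha> s \<sigma> \<mu> \<sigma>1 \<sigma>2 \<sigma>3 N1 N2 N3 = resonant_sum \<alpha> s \<sigma> \<mu> \<sigma>1 \<sigma>3 \<sigma>2 N1 N3 N2"
  unfolding resonant_sum_def
  by (subst (2) sum.swap) (simp add: phase_def add_ac mult_ac)

text \<open>The left-hand side is \<open>N1 powr (2 * s - 2 + 2 * \<alpha>) * N2 powr (2 * \<alpha>) * N3 powr (2 * \<alpha> - 1/2)\<close>. The case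
  distinction in \<open>s_crit\<close> is the sign of the last exponent: for \<open>\<alpha> < 1/4\<close> the smallest frequency is
  worst at 1, otherwise it is worst at \<open>N1\<close>.\<close>

lemma exponent_bookkeeping:
  fixes \<alpha> s N1 N2 N3 :: real
  assumes "0 < \<alpha>" and "1 \<le> N3" "N3 \<le> N2" "N2 \<le> N1"
  shows "N1 powr (-2 + 2 * \<alpha>) * N2 powr (-2 + 2 * \<alpha>) * N3 powr (-2 + 2 * \<alpha>)
      * (N1 powr (2 * s) * N2\<^sup>2 * N3 powr (3/2)) \<le> N1 powr (2 * (s - s_crit \<alpha>))"
proof -
  have N2: "N2\<^sup>2 = N2 powr 2" using assms by simp
  have "N1 powr (-2 + 2 * \<alpha>) * N2 powr (-2 + 2 * \<alpha>) * N3 powr (-2 + 2 * \<alpha>)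
      * (N1 powr (2 * s) * N2\<^sup>2 * N3 powr (3/2))
    = (N1 powr (-2 + 2 * \<alpha>) * N1 powr (2 * s)) * (N2 powr (-2 + 2 * \<alpha>) * N2 powr 2)
      * (N3 powr (-2 + 2 * \<alpha>) * N3 powr (3/2))"
    unfolding N2 by (simp only: mult_ac)
  also have "\<dots> = N1 powr (2 * s - 2 + 2 * \<alpha>) * N2 powr (2 * \<alpha>) * N3 powr (2 * \<alpha> - 1/2)"
    by (simp add: powr_add[symmetric] algebra_simps)
  also have "\<dots> \<le> N1 powr (2 * s - 2 + 2 * \<alpha>) * N1 powr (2 * \<alpha>) * N1 powr (max 0 (2 * \<alpha> - 1/2))"
  proof (intro mult_mono)
    show "N2 powr (2 * \<alpha>) \<le> N1 powr (2 * \<alpha>)" using assms by (intro powr_mono2) auto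
    have "N3 powr (2 * \<alpha> - 1/2) \<le> N3 powr (max 0 (2 * \<alpha> - 1/2))"
      using assms by (intro powr_mono) auto
    also have "\<dots> \<le> N1 powr (max 0 (2 * \<alpha> - 1/2))" using assms by (intro powr_mono2) auto
    finally show "N3 powr (2 * \<alpha> - 1/2) \<le> N1 powr (max 0 (2 * \<alpha> - 1/2))" .
  qed auto
  also have "\<dots> = N1 powr (2 * (s - s_crit \<alpha>))"
    by (simp add: powr_add[symmetric] s_crit_def max_def algebra_simps)
  finally show ?thesis .
qed

lemma resonant_sum_bound_ordered:
  fixes \<alpha> s :: real
  assumes "0 < \<alpha>" "\<alpha> < 1" "0 < s"
  shows "\<exists>C>0. \<forall>\<sigma> \<mu> \<sigma>1 \<sigma>2 \<sigma>3 N1 N2 N3. \<sigma>1 \<in> {1, -1} \<longrightarrow> \<sigma>2 \<in> {1, -1} \<longrightarrow>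
      dyadic N1 \<longrightarrow> dyadic N2 \<longrightarrow> dyadic N3 \<longrightarrow> N3 \<le> N2 \<longrightarrow> N2 \<le> N1 \<longrightarrow>
      resonant_sum \<alpha> s \<sigma> \<mu> \<sigma>1 \<sigma>2 \<sigma>3 N1 N2 N3 \<le> C * N1 powr (2 * (s - s_crit \<alpha>))"
proof -
  obtain C where C: "C > 0" and bound: "\<And>\<sigma> \<sigma>1 \<sigma>2 \<sigma>3 \<mu> N1 N2 N3. \<sigma>1 \<in> {1, -1} \<Longrightarrow> \<sigma>2 \<in> {1, -1} \<Longrightarrow>
      dyadic N1 \<Longrightarrow> dyadic N2 \<Longrightarrow> dyadic N3 \<Longrightarrow> N3 \<le> N2 \<Longrightarrow> N2 \<le> N1 \<Longrightarrow>
      (\<Sum>n3\<in>dyadic_shell N3. \<Sum>n2\<in>dyadic_shell N2. \<Sum>n1\<in>dyadic_shell N1.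
        japanese_bracket (n1 + n2 + n3) powr (2 * (s - 1))
          * of_bool (\<bar>phase \<sigma> \<sigma>1 \<sigma>2 \<sigma>3 n1 n2 n3 - \<mu>\<bar> \<le> 1))
      \<le> C * (N1 powr (2 * s) * N2\<^sup>2 * N3 powr (3/2))"
    using sum_resonant_triples_le[OF assms(3)] by blast
  have "resonant_sum \<alpha> s \<sigma> \<mu> \<sigma>1 \<sigma>2 \<sigma>3 N1 N2 N3 \<le> 64 * C * N1 powr (2 * (s - s_crit \<alpha>))"
    if eps: "\<sigma>1 \<in> {1, -1}" "\<sigma>2 \<in> {1, -1}" and dy: "dyadic N1" "dyadic N2" "dyadic N3"
      and ord: "N3 \<le> N2" "N2 \<le> N1" for \<sigma> \<mu> \<sigma>1 \<sigma>2 \<sigma>3 N1 N2 N3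
  proof -
    have N: "1 \<le> N1" "1 \<le> N2" "1 \<le> N3" using dy by (auto dest: dyadic_ge_1)
    define w where "w = (\<lambda>N. N powr (-2 + 2 * \<alpha>))"
    define g where "g = (\<lambda>n1 n2 n3. japanese_bracket (n1 + n2 + n3) powr (2 * (s - 1))
          * of_bool (\<bar>phase \<sigma> \<sigma>1 \<sigma>2 \<sigma>3 n1 n2 n3 - \<mu>\<bar> \<le> 1))"
    have "resonant_sum \<alpha> s \<sigma> \<mu> \<sigma>1 \<sigma>2 \<sigma>3 N1 N2 N3
        = (\<Sum>n1\<in>dyadic_shell N1. \<Sum>n2\<in>dyadic_shell N2. \<Sum>n3\<in>dyadic_shell N3.
            (w (japanese_bracket n1) * w (japanese_bracket n2) * w (japanese_bracket n3)) * g n1 n2 n3)"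
      by (simp add: resonant_sum_def w_def g_def mult_ac)
    also have "\<dots> \<le> (\<Sum>n1\<in>dyadic_shell N1. \<Sum>n2\<in>dyadic_shell N2. \<Sum>n3\<in>dyadic_shell N3.
            (4 * w N1 * (4 * w N2) * (4 * w N3)) * g n1 n2 n3)"
      unfolding w_def
      by (intro sum_mono mult_right_mono mult_mono weight_on_dyadic_shell N assms mult_nonneg_nonneg)
        (auto simp: g_def)
    also have "\<dots> = 64 * (w N1 * w N2 * w N3)
        * (\<Sum>n1\<in>dyadic_shell N1. \<Sum>n2\<in>dyadic_shell N2. \<Sum>n3\<in>dyadic_shell N3. g n1 n2 n3)"
      by (simp add: sum_distrib_left mult.assoc)
    also have "(\<Sum>n1\<in>dyadic_shell N1. \<Sum>n2\<in>dyadic_shell N2. \<Sum>n3\<in>dyadic_shell N3. g n1 n2 n3)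
        = (\<Sum>n3\<in>dyadic_shell N3. \<Sum>n2\<in>dyadic_shell N2. \<Sum>n1\<in>dyadic_shell N1. g n1 n2 n3)"
    proof -
      have "(\<Sum>n1\<in>dyadic_shell N1. \<Sum>n2\<in>dyadic_shell N2. \<Sum>n3\<in>dyadic_shell N3. g n1 n2 n3)
          = (\<Sum>n1\<in>dyadic_shell N1. \<Sum>n3\<in>dyadic_shell N3. \<Sum>n2\<in>dyadic_shell N2. g n1 n2 n3)"
        by (rule sum.cong[OF refl sum.swap])
      also have "\<dots> = (\<Sum>n3\<in>dyadic_shell N3. \<Sum>n1\<in>dyadic_shell N1. \<Sum>n2\<in>dyadic_shell N2. g n1 n2 n3)"
        by (rule sum.swap)
      also have "\<dots> = (\<Sum>n3\<in>dyadic_shell N3. \<Sum>n2\<in>dyadic_shell N2. \<Sum>n1\<in>dyadic_shell N1. g n1 n2 n3)"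
        by (rule sum.cong[OF refl sum.swap])
      finally show ?thesis .
    qed
    also have "64 * (w N1 * w N2 * w N3) * \<dots>
        \<le> 64 * (w N1 * w N2 * w N3) * (C * (N1 powr (2 * s) * N2\<^sup>2 * N3 powr (3/2)))"
      unfolding g_def by (intro mult_left_mono bound eps dy ord) (simp add: w_def)
    also have "\<dots> = 64 * C * (w N1 * w N2 * w N3 * (N1 powr (2 * s) * N2\<^sup>2 * N3 powr (3/2)))"
      by (simp only: mult_ac)
    also have "\<dots> \<le> 64 * C * N1 powr (2 * (s - s_crit \<alpha>))"
      unfolding w_def using C assms(1) N ord by (intro mult_left_mono exponent_bookkeeping) auto
    finally show ?thesis .
  qed
  then show ?thesis using C by (intro exI[of _ "64 * C"]) auto
qed

lemma resonant_sum_bound: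
  fixes \<alpha> s :: real
  assumes "0 < \<alpha>" "\<alpha> < 1" "0 < s"
  shows "\<exists>C>0. \<forall>\<sigma> \<mu> \<sigma>1 \<sigma>2 \<sigma>3 N1 N2 N3.
      \<sigma>1 \<in> {1, -1} \<longrightarrow> \<sigma>2 \<in> {1, -1} \<longrightarrow> \<sigma>3 \<in> {1, -1} \<longrightarrow>
      dyadic N1 \<longrightarrow> dyadic N2 \<longrightarrow> dyadic N3 \<longrightarrow>
      resonant_sum \<alpha> s \<sigma> \<mu> \<sigma>1 \<sigma>2 \<sigma>3 N1 N2 N3 \<le> C * Max {N1, N2, N3} powr (2 * (s - s_crit \<alpha>))"
proof -
  obtain C where C: "C > 0" and ordered: "\<And>\<sigma> \<mu> \<sigma>1 \<sigma>2 \<sigma>3 N1 N2 N3. \<sigma>1 \<in> {1, -1} \<Longrightarrow> \<sigma>2 \<in> {1, -1} \<Longrightarrow>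
      dyadic N1 \<Longrightarrow> dyadic N2 \<Longrightarrow> dyadic N3 \<Longrightarrow> N3 \<le> N2 \<Longrightarrow> N2 \<le> N1 \<Longrightarrow>
      resonant_sum \<alpha> s \<sigma> \<mu> \<sigma>1 \<sigma>2 \<sigma>3 N1 N2 N3 \<le> C * N1 powr (2 * (s - s_crit \<alpha>))"
    using resonant_sum_bound_ordered[OF assms] by metis
  have top: "resonant_sum \<alpha> s \<sigma> \<mu> \<sigma>1 \<sigma>2 \<sigma>3 N1 N2 N3 \<le> C * N1 powr (2 * (s - s_crit \<alpha>))"
    if "\<sigma>1 \<in> {1, -1}" "\<sigma>2 \<in> {1, -1}" "\<sigma>3 \<in> {1, -1}" "dyadic N1" "dyadic N2" "dyadic N3"
      "N2 \<le> N1" "N3 \<le> N1" for \<sigma> \<mu> \<sigma>1 \<sigma>2 \<sigma>3 N1 N2 N3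
  proof (cases "N3 \<le> N2")
    case True
    then show ?thesis using that by (intro ordered) auto
  next
    case False
    then show ?thesis using that by (subst resonant_sum_swap23) (intro ordered, auto)
  qed
  have "resonant_sum \<alpha> s \<sigma> \<mu> \<sigma>1 \<sigma>2 \<sigma>3 N1 N2 N3 \<le> C * Max {N1, N2, N3} powr (2 * (s - s_crit \<alpha>))"
    if eps: "\<sigma>1 \<in> {1, -1}" "\<sigma>2 \<in> {1, -1}" "\<sigma>3 \<in> {1, -1}" and dy: "dyadic N1" "dyadic N2" "dyadic N3"
    for \<sigma> \<mu> \<sigma>1 \<sigma>2 \<sigma>3 N1 N2 N3
  proof -
    consider "N2 \<le> N1" "N3 \<le> N1" | "N1 \<le> N2" "N3 \<le> N2" | "N1 \<le> N3" "N2 \<le> N3" by linarith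
    then show ?thesis
    proof cases
      case 1
      then have "Max {N1, N2, N3} = N1" by (simp add: max_def)
      then show ?thesis using top[OF eps dy] 1 by simp
    next
      case 2
      then have "Max {N1, N2, N3} = N2" by (simp add: max_def)
      then show ?thesis using top[OF eps(2,1,3) dy(2,1,3)] 2 by (subst resonant_sum_swap12) simp
    next
      case 3
      then have "Max {N1, N2, N3} = N3" by (simp add: max_def)
      then show ?thesis using top[OF eps(3,1,2) dy(3,1,2)] 3
        by (subst resonant_sum_swap23, subst resonant_sum_swap12) simp
    qed
  qed
  then show ?thesis using C by blast
qed

theorem proposition10p7:
  fixes \<alpha> s \<sigma> \<sigma>1 \<sigma>2 \<sigma>3 :: real
  assumes "0 < \<alpha>" and "\<alpha> < 5/12"
    and "\<sigma> \<in> {1, -1}" and "\<sigma>1 \<in> {1, -1}" and "\<sigma>2 \<in> {1, -1}" and "\<sigma>3 \<in> {1, -1}"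
    and "s > 0"
  shows "\<exists>C::real. C > 0 \<and> (\<forall>N1 N2 N3. dyadic N1 \<longrightarrow> dyadic N2 \<longrightarrow> dyadic N3 \<longrightarrow>
    (SUP m::int. \<Sum>\<^sub>\<infinity>(n1, n2, n3)\<in>UNIV. ennreal (
        japanese_bracket (n1 + n2 + n3) powr (2 * (s - 1))
        * ((of_bool (size_comparable n1 N1) * japanese_bracket n1 powr (-2 + 2 * \<alpha>))
          * (of_bool (size_comparable n2 N2) * japanese_bracket n2 powr (-2 + 2 * \<alpha>))
          * (of_bool (size_comparable n3 N3) * japanese_bracket n3 powr (-2 + 2 * \<alpha>)))
        * of_bool (\<bar>phase \<sigma> \<sigma>1 \<sigma>2 \<sigma>3 n1 n2 n3 - of_int m\<bar> \<le> 1)))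
    \<le> ennreal (C * Max {N1, N2, N3} powr (2 * (s - s_crit \<alpha>))))"
proof -
  have "\<alpha> < 1" using assms(2) by simp
  then obtain C where C: "C > 0" and bound: "\<And>\<mu> N1 N2 N3. dyadic N1 \<Longrightarrow> dyadic N2 \<Longrightarrow> dyadic N3 \<Longrightarrow>
      resonant_sum \<alpha> s \<sigma> \<mu> \<sigma>1 \<sigma>2 \<sigma>3 N1 N2 N3 \<le> C * Max {N1, N2, N3} powr (2 * (s - s_crit \<alpha>))"
    using resonant_sum_bound[of \<alpha> s] assms by metis
  show ?thesis
  proof (intro exI[of _ C] conjI C allI impI SUP_least)
    fix N1 N2 N3 :: real and m :: int
    assume dy: "dyadic N1" "dyadic N2" "dyadic N3"
    let ?F = "dyadic_shell N1 \<times> dyadic_shell N2 \<times> dyadic_shell N3"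
    let ?g = "\<lambda>(n1, n2, n3). japanese_bracket (n1 + n2 + n3) powr (2 * (s - 1))
      * (japanese_bracket n1 powr (-2 + 2 * \<alpha>) * japanese_bracket n2 powr (-2 + 2 * \<alpha>)
        * japanese_bracket n3 powr (-2 + 2 * \<alpha>))
      * of_bool (\<bar>phase \<sigma> \<sigma>1 \<sigma>2 \<sigma>3 n1 n2 n3 - of_int m\<bar> \<le> 1)"
    have fin: "finite ?F" using dy by (intro finite_cartesian_product finite_dyadic_shell dyadic_ge_1)
    have "(\<Sum>\<^sub>\<infinity>(n1, n2, n3)\<in>UNIV. ennreal (
        japanese_bracket (n1 + n2 + n3) powr (2 * (s - 1))
        * ((of_bool (size_comparable n1 N1) * japanese_bracket n1 powr (-2 + 2 * \<alpha>))
          * (of_bool (size_comparable n2 N2) * japanese_bracket n2 powr (-2 + 2 * \<alpha>))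
          * (of_bool (size_comparable n3 N3) * japanese_bracket n3 powr (-2 + 2 * \<alpha>)))
        * of_bool (\<bar>phase \<sigma> \<sigma>1 \<sigma>2 \<sigma>3 n1 n2 n3 - of_int m\<bar> \<le> 1)))
      = (\<Sum>\<^sub>\<infinity>x\<in>?F. ennreal (?g x))"
      by (rule infsum_cong_neutral) (auto simp: dyadic_shell_def)
    also have "\<dots> = (\<Sum>x\<in>?F. ennreal (?g x))" using fin by (rule infsum_finite)
    also have "\<dots> = ennreal (\<Sum>x\<in>?F. ?g x)" by (rule sum_ennreal) auto
    also have "(\<Sum>x\<in>?F. ?g x) = resonant_sum \<alpha> s \<sigma> (of_int m) \<sigma>1 \<sigma>2 \<sigma>3 N1 N2 N3"
      by (simp add: resonant_sum_def sum.cartesian_product)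
    also have "ennreal \<dots> \<le> ennreal (C * Max {N1, N2, N3} powr (2 * (s - s_crit \<alpha>)))"
      using dy by (intro ennreal_leI bound)
    finally show "(\<Sum>\<^sub>\<infinity>(n1, n2, n3)\<in>UNIV. ennreal (
        japanese_bracket (n1 + n2 + n3) powr (2 * (s - 1))
        * ((of_bool (size_comparable n1 N1) * japanese_bracket n1 powr (-2 + 2 * \<alpha>))
          * (of_bool (size_comparable n2 N2) * japanese_bracket n2 powr (-2 + 2 * \<alpha>))
          * (of_bool (size_comparable n3 N3) * japanese_bracket n3 powr (-2 + 2 * \<alpha>)))
        * of_bool (\<bar>phase \<sigma> \<sigma>1 \<sigma>2 \<sigma>3 n1 n2 n3 - of_int m\<bar> \<le> 1)))
      \<le> ennreal (C * Max {N1, N2, N3} powr (2 * (s - s_crit \<alpha>)))" .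
  qed
qed

end
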